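(* Let $\gamma$ be the global kernel of the nonlocal interface problem defined in the context, and assume $\gamma$ is of type 1 or of type 2. Let $\zeta=(\zeta_1,\zeta_2)\in V_\delta'$ and $\nu\in V_\delta'$. Then there exists a unique $u\in V_\delta$ such that, for all $v\in V_\delta$, $$\iint_{(\Omega\cup\mathcal I)^2}(u(\mathbf x)-u(\mathbf y))(v(\mathbf x)-v(\mathbf y))\,\gamma(\mathbf x,\mathbf y;\delta)\,d\mathbf y\,d\mathbf x=\int_\Omega \zeta\, v\,d\mathbf x+\int_{\Gamma\cup\Omega_2^J}\nu\, v\,d\mathbf x .$$
   Context: **Geometry.** $n\in\{1,2,3\}$; $\Omega_1,\Omega_2\subset\mathbb R^n$ are open domains with $\Omega_1\cap\Omega_2=\emptyset$ and $\Gamma_0:=\partial\Omega_1\cap\partial\Omega_2\neq\emptyset$. $|\cdot|$ is the Euclidean norm. The horizons satisfy $0<\delta_1\le\delta_2$, and $\delta=(\delta_1,\delta_2)$. For $i\in\{1,2\}$ put $j:=3-i$ and - $\mathcal I_i:=\{\mathbf y\in\mathbb R^n\setminus\Omega_i:\ |\mathbf x-\mathbf y|<\delta_i \text{ for some }\mathbf x\in\Omega_i\}$ (interaction domain), - $\mathcal I_i^J:=\mathcal I_i\cap\Omega_j$, $\mathcal I_i^D:=\mathcal I_i\setminus\mathcal I_i^J$, - $\Gamma:=\mathcal I_1^J\cup\mathcal I_2^J\cup\Gamma_0$ (nonlocal interface), - $\Omega_i^J:=\{\mathbf y\in\Omega_i\setminus\mathcal I_j^J:\ |\mathbf x-\mathbf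 y|<\delta_i\text{ for some }\mathbf x\in\mathcal I_i^J\}$. Further, $\Omega:=\Omega_1\cup\Omega_2\cup\Gamma_0$ and $\Omega\cup\mathcal I:=\Omega\cup\mathcal I_1\cup\mathcal I_2$. **Kernels.** For $i=1,2$, $\gamma_i(\mathbf x,\mathbf y;\delta_i)$ is a nonnegative symmetric kernel vanishing for $|\mathbf x-\mathbf y|\ge\delta_i$, and $\gamma_i^J(\mathbf x,\mathbf y;\delta_i)$ is a symmetric kernel vanishing for $|\mathbf x-\mathbf y|\ge\delta_i$. Define on $(\Omega_i\cup\mathcal I_i)^2$ $$\tilde\gamma_i(\mathbf x,\mathbf y;\delta_i)=\begin{cases}0&\text{on }(\mathcal I_i^J\cup\mathcal I_i^D)^2,\\ \gamma_i^J(\mathbf x,\mathbf y;\delta_i)&\text{on }[\Omega_i\times\mathcal I_i^J]\cup[\mathcal I_i^J\times\Omega_i],\\ \gamma_i(\mathbf x,\mathbf y;\delta_i)&\text{on }(\Omega_i\cup\mathcal I_i^D)^2\setminus(\mathcal I_i^D)^2,\end{cases}$$ and the global symmetric kernel $\gamma:=\tilde\gamma_1\,\chi_{(\Omega_1\cup\mathcal I_1)^2}+\tilde\gamma_2\,\chi_{(\Omega_2\cup\mathcal I_2)^2}$, where $\chi_A$ is the indicator function of $A$ (each product is $0$ off its set). **Energy space.** A global function $v$ on $\Omega\cup\mathcal I$ is identified with the pair $(v_1,v_2)$, $v_i=v|_{\Omega_i\cup\mathcal I_i}$. Put $$|||v|||_\delta^2:=\iint_{(\Omega\cup\mathcal I)^2}(v(\mathbf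 x)-v(\mathbf y))^2\gamma(\mathbf x,\mathbf y;\delta)\,d\mathbf y\,d\mathbf x,$$ $$V_\delta:=\{v\in L^2(\Omega\cup\mathcal I):\ |||v|||_\delta<\infty,\ v_i=0\text{ in }\mathcal I_i^D\ (i=1,2),\ v_1=v_2\text{ in }\Gamma\}.$$ $V_\delta'$ is the dual space of $V_\delta$. $\zeta$ denotes the function equal to $\zeta_i$ on $\Omega_i$; $\nu$, given on $\Gamma\cup\Omega_2^J$, is extended by zero, so that the integrals $\int_\Omega\zeta v$ and $\int_{\Gamma\cup\Omega_2^J}\nu v$ are understood as the duality pairings of $\zeta,\nu\in V_\delta'$ with $v\in V_\delta$. **Kernel classes.** - Type 1 (fractional): $\gamma(\mathbf x,\mathbf y;\delta)\propto|\mathbf x-\mathbf y|^{-(n+2s)}\mathcal X(|\mathbf x-\mathbf y|<\bar\delta)$ with $\bar\delta=\max_i\delta_i$, $s\in(0,1)$, and $\mathcal X$ the indicator function. - Type 2 (square integrable): $\int_{\Omega\cup\mathcal I}\gamma(\mathbf x,\mathbf y;\delta)^2\,d\mathbf y<\infty$. Standing property of these kernel classes (from the nonlocal vector calculus, taken as known): on $V_\delta$, $|||\cdot|||_\delta$ is equivalent to $\|\cdot\|_{H^s(\Omega\cup\mathcal I)}$ for type 1 and to $\|\cdot\|_{L^2(\Omega\cup\mathcal I)}$ for type 2; in particular $|||\cdot|||_\delta$ is a norm on $V_\delta$ and $V_\delta$ is complete with respect to it. *)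

theory Defs
  imports "HOL-Analysis.Analysis"
begin

section \<open>Geometry\<close>

text \<open>
  The two subdomains, the two horizons and the kernels of the two subdomains are families
  indexed by \<open>i \<in> {1, 2} :: nat set\<close>; the other index is \<open>3 - i\<close>. Values at other indices are
  never used. In names, \<open>_J\<close> and \<open>_D\<close> stand for the superscripts \<open>J\<close> (joint, inside the other
  subdomain) and \<open>D\<close> (Dirichlet).
\<close>

definition interaction_domain ::
    "(nat \<Rightarrow> (real ^ 'n) set) \<Rightarrow> (nat \<Rightarrow> real) \<Rightarrow> nat \<Rightarrow> (real ^ 'n) set" where
  "interaction_domain Om \<delta> i = {y. y \<notin> Om i \<and> (\<exists>x\<in>Om i. norm (x - y) < \<delta> i)}"

definition interaction_J ::
    "(nat \<Rightarrow> (real ^ 'n) set) \<Rightarrow> (nat \<Rightarrow> real) \<Rightarrow> nat \<Rightarrow> (real ^ 'n) set" where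
  "interaction_J Om \<delta> i = interaction_domain Om \<delta> i \<inter> Om (3 - i)"

definition interaction_D ::
    "(nat \<Rightarrow> (real ^ 'n) set) \<Rightarrow> (nat \<Rightarrow> real) \<Rightarrow> nat \<Rightarrow> (real ^ 'n) set" where
  "interaction_D Om \<delta> i = interaction_domain Om \<delta> i - interaction_J Om \<delta> i"

definition local_interface :: "(nat \<Rightarrow> (real ^ 'n) set) \<Rightarrow> (real ^ 'n) set" where
  "local_interface Om = frontier (Om 1) \<inter> frontier (Om 2)"

definition nonlocal_interface ::
    "(nat \<Rightarrow> (real ^ 'n) set) \<Rightarrow> (nat \<Rightarrow> real) \<Rightarrow> (real ^ 'n) set" where
  "nonlocal_interface Om \<delta> =
     interaction_J Om \<delta> 1 \<union> interaction_J Om \<delta> 2 \<union> local_interface Om"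

definition extended_subdomain ::
    "(nat \<Rightarrow> (real ^ 'n) set) \<Rightarrow> (nat \<Rightarrow> real) \<Rightarrow> nat \<Rightarrow> (real ^ 'n) set" where
  "extended_subdomain Om \<delta> i = Om i \<union> interaction_domain Om \<delta> i"

definition total_domain ::
    "(nat \<Rightarrow> (real ^ 'n) set) \<Rightarrow> (nat \<Rightarrow> real) \<Rightarrow> (real ^ 'n) set" where
  "total_domain Om \<delta> =
     (Om 1 \<union> Om 2 \<union> local_interface Om) \<union> interaction_domain Om \<delta> 1 \<union> interaction_domain Om \<delta> 2"

definition interface_geometry ::
    "(nat \<Rightarrow> (real ^ 'n) set) \<Rightarrow> (nat \<Rightarrow> real) \<Rightarrow> bool" where
  "interface_geometry Om \<delta> \<longleftrightarrow>
     CARD('n) \<in> {1, 2, 3} \<and>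
     open (Om 1) \<and> open (Om 2) \<and> Om 1 \<inter> Om 2 = {} \<and> local_interface Om \<noteq> {} \<and>
     0 < \<delta> 1 \<and> \<delta> 1 \<le> \<delta> 2"


section \<open>Kernels\<close>

text \<open>
  The subdomain kernel \<open>g i\<close> is nonnegative; no sign is imposed on the coupling kernel \<open>gJ i\<close>.
  Values are real, so a kernel that is singular on the diagonal takes an arbitrary finite value
  there; the diagonal is a null set.
\<close>

definition admissible_kernels ::
    "(nat \<Rightarrow> (real ^ 'n) set) \<Rightarrow> (nat \<Rightarrow> real) \<Rightarrow>
     (nat \<Rightarrow> real ^ 'n \<Rightarrow> real ^ 'n \<Rightarrow> real) \<Rightarrow> (nat \<Rightarrow> real ^ 'n \<Rightarrow> real ^ 'n \<Rightarrow> real) \<Rightarrow> bool" where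
  "admissible_kernels Om \<delta> g gJ \<longleftrightarrow>
     (\<forall>i\<in>{1, 2}. let E = extended_subdomain Om \<delta> i in
        (\<lambda>(x, y). g i x y) \<in> borel_measurable (lebesgue_on (E \<times> E)) \<and>
        (\<lambda>(x, y). gJ i x y) \<in> borel_measurable (lebesgue_on (E \<times> E)) \<and>
        (\<forall>x\<in>E. \<forall>y\<in>E.
           0 \<le> g i x y \<and> g i x y = g i y x \<and> gJ i x y = gJ i y x \<and>
           (norm (x - y) \<ge> \<delta> i \<longrightarrow> g i x y = 0 \<and> gJ i x y = 0)))"

definition subdomain_kernel ::
    "(nat \<Rightarrow> (real ^ 'n) set) \<Rightarrow> (nat \<Rightarrow> real) \<Rightarrow>
     (nat \<Rightarrow> real ^ 'n \<Rightarrow> real ^ 'n \<Rightarrow> real) \<Rightarrow> (nat \<Rightarrow> real ^ 'n \<Rightarrow> real ^ 'n \<Rightarrow> real) \<Rightarrow>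
     nat \<Rightarrow> real ^ 'n \<Rightarrow> real ^ 'n \<Rightarrow> real" where
  "subdomain_kernel Om \<delta> g gJ i x y =
     (let J = interaction_J Om \<delta> i; D = interaction_D Om \<delta> i in
      if (x, y) \<in> (J \<union> D) \<times> (J \<union> D) then 0
      else if (x, y) \<in> Om i \<times> J \<union> J \<times> Om i then gJ i x y
      else if (x, y) \<in> (Om i \<union> D) \<times> (Om i \<union> D) - D \<times> D then g i x y
      else 0)"

definition global_kernel ::
    "(nat \<Rightarrow> (real ^ 'n) set) \<Rightarrow> (nat \<Rightarrow> real) \<Rightarrow>
     (nat \<Rightarrow> real ^ 'n \<Rightarrow> real ^ 'n \<Rightarrow> real) \<Rightarrow> (nat \<Rightarrow> real ^ 'n \<Rightarrow> real ^ 'n \<Rightarrow> real) \<Rightarrow>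
     real ^ 'n \<Rightarrow> real ^ 'n \<Rightarrow> real" where
  "global_kernel Om \<delta> g gJ x y =
     (\<Sum>i\<in>{1, 2}. subdomain_kernel Om \<delta> g gJ i x y *
        indicator (extended_subdomain Om \<delta> i \<times> extended_subdomain Om \<delta> i) (x, y))"


section \<open>Function spaces\<close>

text \<open>
  Elements of the function spaces are represented by functions on the whole space, of which only
  the values on the domain matter, up to null sets.
\<close>

definition L2_space :: "(real ^ 'n) set \<Rightarrow> (real ^ 'n \<Rightarrow> real) set" where
  "L2_space A = {v. v \<in> borel_measurable (lebesgue_on A) \<and> integrable (lebesgue_on A) (\<lambda>x. (v x)\<^sup>2)}"

definition L2_norm :: "(real ^ 'n) set \<Rightarrow> (real ^ 'n \<Rightarrow> real) \<Rightarrow> real" where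
  "L2_norm A v = sqrt (LINT x|lebesgue_on A. (v x)\<^sup>2)"

definition gagliardo_quotient :: "real \<Rightarrow> (real ^ 'n \<Rightarrow> real) \<Rightarrow> real ^ 'n \<Rightarrow> real ^ 'n \<Rightarrow> real" where
  "gagliardo_quotient s v x y = (v x - v y)\<^sup>2 / norm (x - y) powr (real CARD('n) + 2 * s)"

definition Hs_space :: "real \<Rightarrow> (real ^ 'n) set \<Rightarrow> (real ^ 'n \<Rightarrow> real) set" where
  "Hs_space s A = {v \<in> L2_space A.
     integrable (lebesgue_on (A \<times> A)) (\<lambda>(x, y). gagliardo_quotient s v x y)}"

definition Hs_norm :: "real \<Rightarrow> (real ^ 'n) set \<Rightarrow> (real ^ 'n \<Rightarrow> real) \<Rightarrow> real" where
  "Hs_norm s A v = sqrt ((L2_norm A v)\<^sup>2 +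
     (LINT (x, y)|lebesgue_on (A \<times> A). gagliardo_quotient s v x y))"

definition energy_form ::
    "(nat \<Rightarrow> (real ^ 'n) set) \<Rightarrow> (nat \<Rightarrow> real) \<Rightarrow>
     (nat \<Rightarrow> real ^ 'n \<Rightarrow> real ^ 'n \<Rightarrow> real) \<Rightarrow> (nat \<Rightarrow> real ^ 'n \<Rightarrow> real ^ 'n \<Rightarrow> real) \<Rightarrow>
     (real ^ 'n \<Rightarrow> real) \<Rightarrow> (real ^ 'n \<Rightarrow> real) \<Rightarrow> real" where
  "energy_form Om \<delta> g gJ u v =
     (LINT (x, y)|lebesgue_on (total_domain Om \<delta> \<times> total_domain Om \<delta>).
        (u x - u y) * (v x - v y) * global_kernel Om \<delta> g gJ x y)"

definition energy_norm ::
    "(nat \<Rightarrow> (real ^ 'n) set) \<Rightarrow> (nat \<Rightarrow> real) \<Rightarrow>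
     (nat \<Rightarrow> real ^ 'n \<Rightarrow> real ^ 'n \<Rightarrow> real) \<Rightarrow> (nat \<Rightarrow> real ^ 'n \<Rightarrow> real ^ 'n \<Rightarrow> real) \<Rightarrow>
     (real ^ 'n \<Rightarrow> real) \<Rightarrow> real" where
  "energy_norm Om \<delta> g gJ v = sqrt (energy_form Om \<delta> g gJ v v)"

definition component ::
    "(nat \<Rightarrow> (real ^ 'n) set) \<Rightarrow> (nat \<Rightarrow> real) \<Rightarrow> (real ^ 'n \<Rightarrow> real) \<Rightarrow> nat \<Rightarrow> real ^ 'n \<Rightarrow> real" where
  "component Om \<delta> v i = restrict v (extended_subdomain Om \<delta> i)"

text \<open>
  Finiteness of the energy of \<open>v\<close> is (absolute) integrability of its integrand; as the coupling
  kernels may change sign, this is what makes the double integral meaningful. Since a global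
  function is identified with the pair of its components, the transmission condition on the
  nonlocal interface holds by construction; it is kept as part of the definition.
\<close>

definition energy_space ::
    "(nat \<Rightarrow> (real ^ 'n) set) \<Rightarrow> (nat \<Rightarrow> real) \<Rightarrow>
     (nat \<Rightarrow> real ^ 'n \<Rightarrow> real ^ 'n \<Rightarrow> real) \<Rightarrow> (nat \<Rightarrow> real ^ 'n \<Rightarrow> real ^ 'n \<Rightarrow> real) \<Rightarrow>
     (real ^ 'n \<Rightarrow> real) set" where
  "energy_space Om \<delta> g gJ = {v \<in> L2_space (total_domain Om \<delta>).
     integrable (lebesgue_on (total_domain Om \<delta> \<times> total_domain Om \<delta>))
       (\<lambda>(x, y). (v x - v y)\<^sup>2 * global_kernel Om \<delta> g gJ x y) \<and>
     (\<forall>i\<in>{1, 2}. AE x in lebesgue_on (interaction_D Om \<delta> i). component Om \<delta> v i x = 0) \<and>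
     (AE x in lebesgue_on (nonlocal_interface Om \<delta>). component Om \<delta> v 1 x = component Om \<delta> v 2 x)}"

text \<open>
  The dual space consists of the linear functionals on the energy space that are bounded with
  respect to the energy norm; the pairing with \<open>v\<close> is application to \<open>v\<close>. Boundedness makes
  such a functional respect almost everywhere equality, since the energy of a function that
  vanishes almost everywhere is zero. An interface source given only near the interface and
  extended by zero enters as an element of this space.
\<close>

definition dual_energy_space ::
    "(nat \<Rightarrow> (real ^ 'n) set) \<Rightarrow> (nat \<Rightarrow> real) \<Rightarrow>
     (nat \<Rightarrow> real ^ 'n \<Rightarrow> real ^ 'n \<Rightarrow> real) \<Rightarrow> (nat \<Rightarrow> real ^ 'n \<Rightarrow> real ^ 'n \<Rightarrow> real) \<Rightarrow>
     ((real ^ 'n \<Rightarrow> real) \<Rightarrow> real) set" where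
  "dual_energy_space Om \<delta> g gJ = {\<phi>.
     (\<forall>u\<in>energy_space Om \<delta> g gJ. \<forall>v\<in>energy_space Om \<delta> g gJ. \<forall>a b.
        \<phi> (\<lambda>x. a * u x + b * v x) = a * \<phi> u + b * \<phi> v) \<and>
     (\<exists>C. \<forall>v\<in>energy_space Om \<delta> g gJ. \<bar>\<phi> v\<bar> \<le> C * energy_norm Om \<delta> g gJ v)}"


section \<open>Kernel classes\<close>

text \<open>
  The pairs of points whose interaction is not switched off by the construction of the global
  kernel or by the horizons.
\<close>

definition interacting ::
    "(nat \<Rightarrow> (real ^ 'n) set) \<Rightarrow> (nat \<Rightarrow> real) \<Rightarrow> real ^ 'n \<Rightarrow> real ^ 'n \<Rightarrow> bool" where
  "interacting Om \<delta> x y \<longleftrightarrow>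
     (\<exists>i\<in>{1, 2}. x \<in> extended_subdomain Om \<delta> i \<and> y \<in> extended_subdomain Om \<delta> i \<and>
        \<not> (x \<in> interaction_domain Om \<delta> i \<and> y \<in> interaction_domain Om \<delta> i) \<and>
        norm (x - y) < \<delta> i)"

text \<open>
  Proportionality to the fractional kernel. The global kernel vanishes, for instance, on pairs
  of points that both lie in the same interaction domain, and beyond the smaller horizon inside
  the first subdomain; so one nonzero factor for all pairs is not possible in general. The factor
  \<open>\<kappa>\<close> is therefore piecewise constant, with finitely many values, and positive on all
  interacting pairs. A constant positive \<open>\<kappa>\<close> is a special case.
\<close>

definition fractional_kernel ::
    "(nat \<Rightarrow> (real ^ 'n) set) \<Rightarrow> (nat \<Rightarrow> real) \<Rightarrow>
     (nat \<Rightarrow> real ^ 'n \<Rightarrow> real ^ 'n \<Rightarrow> real) \<Rightarrow> (nat \<Rightarrow> real ^ 'n \<Rightarrow> real ^ 'n \<Rightarrow> real) \<Rightarrow>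
     real \<Rightarrow> bool" where
  "fractional_kernel Om \<delta> g gJ s \<longleftrightarrow>
     0 < s \<and> s < 1 \<and>
     (\<exists>\<kappa> :: (real ^ 'n) \<times> (real ^ 'n) \<Rightarrow> real. finite (range \<kappa>) \<and> (\<forall>p. 0 \<le> \<kappa> p) \<and>
        (\<forall>x\<in>total_domain Om \<delta>. \<forall>y\<in>total_domain Om \<delta>. x \<noteq> y \<longrightarrow>
           (interacting Om \<delta> x y \<longrightarrow> 0 < \<kappa> (x, y)) \<and>
           global_kernel Om \<delta> g gJ x y =
             \<kappa> (x, y) * norm (x - y) powr (- (real CARD('n) + 2 * s)) *
             indicator {..<max (\<delta> 1) (\<delta> 2)} (norm (x - y))))"

definition square_integrable_kernel ::
    "(nat \<Rightarrow> (real ^ 'n) set) \<Rightarrow> (nat \<Rightarrow> real) \<Rightarrow>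
     (nat \<Rightarrow> real ^ 'n \<Rightarrow> real ^ 'n \<Rightarrow> real) \<Rightarrow> (nat \<Rightarrow> real ^ 'n \<Rightarrow> real ^ 'n \<Rightarrow> real) \<Rightarrow> bool" where
  "square_integrable_kernel Om \<delta> g gJ \<longleftrightarrow>
     (\<forall>x\<in>total_domain Om \<delta>.
        integrable (lebesgue_on (total_domain Om \<delta>)) (\<lambda>y. (global_kernel Om \<delta> g gJ x y)\<^sup>2))"

definition equivalent_norms_on ::
    "'v set \<Rightarrow> ('v \<Rightarrow> real) \<Rightarrow> ('v \<Rightarrow> real) \<Rightarrow> bool" where
  "equivalent_norms_on V N M \<longleftrightarrow>
     (\<exists>c>0. \<exists>C>0. \<forall>v\<in>V. c * M v \<le> N v \<and> N v \<le> C * M v)"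

definition energy_complete ::
    "(nat \<Rightarrow> (real ^ 'n) set) \<Rightarrow> (nat \<Rightarrow> real) \<Rightarrow>
     (nat \<Rightarrow> real ^ 'n \<Rightarrow> real ^ 'n \<Rightarrow> real) \<Rightarrow> (nat \<Rightarrow> real ^ 'n \<Rightarrow> real ^ 'n \<Rightarrow> real) \<Rightarrow> bool" where
  "energy_complete Om \<delta> g gJ \<longleftrightarrow>
     (\<forall>w :: nat \<Rightarrow> real ^ 'n \<Rightarrow> real.
        (\<forall>k. w k \<in> energy_space Om \<delta> g gJ) \<and>
        (\<forall>e>0. \<exists>N. \<forall>k\<ge>N. \<forall>m\<ge>N. energy_norm Om \<delta> g gJ (\<lambda>x. w k x - w m x) < e) \<longrightarrow>
        (\<exists>v\<in>energy_space Om \<delta> g gJ.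
           (\<lambda>k. energy_norm Om \<delta> g gJ (\<lambda>x. w k x - v x)) \<longlonglongrightarrow> 0))"

text \<open>
  The property of the two kernel classes that the nonlocal vector calculus provides. That the
  energy norm is a norm (on classes modulo almost everywhere equality) is not listed separately:
  it follows from the equivalence, since the energy form is symmetric and bilinear and the
  equivalence makes it positive definite. Completeness is listed, because for a coupling kernel
  without sign it is not an evident consequence of the equivalence.
\<close>

definition kernel_class_property ::
    "(nat \<Rightarrow> (real ^ 'n) set) \<Rightarrow> (nat \<Rightarrow> real) \<Rightarrow>
     (nat \<Rightarrow> real ^ 'n \<Rightarrow> real ^ 'n \<Rightarrow> real) \<Rightarrow> (nat \<Rightarrow> real ^ 'n \<Rightarrow> real ^ 'n \<Rightarrow> real) \<Rightarrow> bool" where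
  "kernel_class_property Om \<delta> g gJ \<longleftrightarrow>
     (\<forall>s. fractional_kernel Om \<delta> g gJ s \<longrightarrow>
        energy_space Om \<delta> g gJ \<subseteq> Hs_space s (total_domain Om \<delta>) \<and>
        equivalent_norms_on (energy_space Om \<delta> g gJ)
          (energy_norm Om \<delta> g gJ) (Hs_norm s (total_domain Om \<delta>)) \<and>
        energy_complete Om \<delta> g gJ) \<and>
     (square_integrable_kernel Om \<delta> g gJ \<longrightarrow>
        equivalent_norms_on (energy_space Om \<delta> g gJ)
          (energy_norm Om \<delta> g gJ) (L2_norm (total_domain Om \<delta>)) \<and>
        energy_complete Om \<delta> g gJ)"

end

theory Submission
  imports Defs
begin

text \<open>
  The equation says that the functional \<open>\<zeta> + \<nu>\<close> is represented by the energy form, so this is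
  the Riesz representation theorem in the energy space. Three things have to be supplied.

  First, the Riesz theorem itself, for a space of functions with a symmetric, positive
  semidefinite form that is complete in its seminorm (\<open>Riesz_representation\<close>). The space
  consists of functions and not of classes modulo null sets, so the form is only semidefinite; the
  representer is a minimiser of \<open>B v v - 2 * \<phi> v\<close>, unique up to functions of zero energy.

  Second, the energy space has to be a linear space on which the energy form is bilinear. This is
  a question of integrability: the coupling kernels may be negative, so the energy
  is not the square of an \<open>L\<^sup>2\<close>-norm with weight. But finite energy means absolute
  integrability, so that \<open>\<bar>a * b * k\<bar> \<le> \<bar>a\<^sup>2 * k\<bar> + \<bar>b\<^sup>2 * k\<bar>\<close> bounds the mixed
  integrand (\<open>integrable_energy_integrand\<close>), once it is known to be measurable for
  the completed Lebesgue measure on the product.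

  Third, the sign. The energy norm is the root of the energy, where the root is extended to an odd
  function; the equivalence of norms bounds it from below by a positive multiple of the
  \<open>L\<^sup>2\<close>-norm (\<open>energy_norm_ge_L2_norm\<close>). So the energy cannot be negative, and it
  vanishes only on functions that are zero almost everywhere. The former makes the form
  semidefinite; the latter gives uniqueness, because the difference of two solutions has zero
  energy. Completeness is part of the property of the two kernel classes.
\<close>

section \<open>Representation of bounded functionals\<close>

definition semidefinite_form :: "('a \<Rightarrow> real) set \<Rightarrow> (('a \<Rightarrow> real) \<Rightarrow> ('a \<Rightarrow> real) \<Rightarrow> real) \<Rightarrow> bool" where
  "semidefinite_form V B \<longleftrightarrow>
     V \<noteq> {} \<and>
     (\<forall>u\<in>V. \<forall>v\<in>V. \<forall>a b. (\<lambda>x. a * u x + b * v x) \<in> V) \<and>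
     (\<forall>u\<in>V. \<forall>v\<in>V. B u v = B v u) \<and>
     (\<forall>u\<in>V. \<forall>v\<in>V. \<forall>w\<in>V. \<forall>a b. B (\<lambda>x. a * u x + b * v x) w = a * B u w + b * B v w) \<and>
     (\<forall>v\<in>V. 0 \<le> B v v)"

lemma semidefinite_form_nonempty: "semidefinite_form V B \<Longrightarrow> V \<noteq> {}"
  by (simp add: semidefinite_form_def)

lemma semidefinite_form_closed:
  "semidefinite_form V B \<Longrightarrow> u \<in> V \<Longrightarrow> v \<in> V \<Longrightarrow> (\<lambda>x. a * u x + b * v x) \<in> V"
  unfolding semidefinite_form_def by blast

lemma semidefinite_form_sym: "semidefinite_form V B \<Longrightarrow> u \<in> V \<Longrightarrow> v \<in> V \<Longrightarrow> B u v = B v u"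
  unfolding semidefinite_form_def by blast

lemma semidefinite_form_linear:
  "semidefinite_form V B \<Longrightarrow> u \<in> V \<Longrightarrow> v \<in> V \<Longrightarrow> w \<in> V \<Longrightarrow>
    B (\<lambda>x. a * u x + b * v x) w = a * B u w + b * B v w"
  unfolding semidefinite_form_def by blast

lemma semidefinite_form_nonneg: "semidefinite_form V B \<Longrightarrow> v \<in> V \<Longrightarrow> 0 \<le> B v v"
  by (simp add: semidefinite_form_def)

lemma semidefinite_form_diff_closed:
  "semidefinite_form V B \<Longrightarrow> u \<in> V \<Longrightarrow> v \<in> V \<Longrightarrow> (\<lambda>x. u x - v x) \<in> V"
  using semidefinite_form_closed[of V B u v 1 "-1"] by simp

lemma form_diff_left:
  "semidefinite_form V B \<Longrightarrow> u \<in> V \<Longrightarrow> v \<in> V \<Longrightarrow> w \<in> V \<Longrightarrow>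
    B (\<lambda>x. u x - v x) w = B u w - B v w"
  using semidefinite_form_linear[of V B u v w 1 "-1"] by simp

lemma form_square_combination:
  assumes form: "semidefinite_form V B" and "u \<in> V" "v \<in> V"
  shows "B (\<lambda>x. a * u x + b * v x) (\<lambda>x. a * u x + b * v x) =
    a\<^sup>2 * B u u + 2 * a * b * B u v + b\<^sup>2 * B v v"
proof -
  note form_sym = semidefinite_form_sym[OF form] and form_linear = semidefinite_form_linear[OF form]
  let ?w = "\<lambda>x. a * u x + b * v x"
  have w: "?w \<in> V"
    using semidefinite_form_closed assms by blast
  have "B ?w ?w = a * B u ?w + b * B v ?w"
    using form_linear assms w by blast
  also have "B u ?w = a * B u u + b * B u v"
    using form_linear[of u v u a b] form_sym[of u ?w] form_sym[of u v] assms w by simp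
  also have "B v ?w = a * B u v + b * B v v"
    using form_linear[of u v v a b] form_sym[of v ?w] assms w by simp
  finally show ?thesis
    by (simp add: power2_eq_square algebra_simps)
qed

lemma form_square_diff:
  assumes "semidefinite_form V B" "u \<in> V" "v \<in> V"
  shows "B (\<lambda>x. u x - v x) (\<lambda>x. u x - v x) = B u u - 2 * B u v + B v v"
  using form_square_combination[OF assms, of 1 "-1"] by simp

text \<open>
  The usual argument divides by \<open>B v v\<close>, which may vanish for \<open>v \<noteq> 0\<close>. In that case the energy of
  \<open>u + t v\<close> is affine in \<open>t\<close>, hence constant, because it is bounded below; so \<open>B u v\<close> is zero.
\<close>

lemma Cauchy_Schwarz_form:
  assumes form: "semidefinite_form V B" and u: "u \<in> V" and v: "v \<in> V"
  shows "\<bar>B u v\<bar> \<le> sqrt (B u u) * sqrt (B v v)"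
proof -
  have comb: "0 \<le> a\<^sup>2 * B u u + 2 * a * b * B u v + b\<^sup>2 * B v v" for a b
    using semidefinite_form_nonneg[OF form semidefinite_form_closed[OF form u v, of a b]]
      form_square_combination[OF form u v, of a b] by simp
  have "(B u v)\<^sup>2 \<le> B u u * B v v"
  proof (cases "B v v = 0")
    case True
    have "B u v = 0"
    proof (rule ccontr)
      assume "B u v \<noteq> 0"
      then show False
        using comb[of 1 "- (B u u + 1) / (2 * B u v)"] True by (simp add: field_simps)
    qed
    then show ?thesis
      using True by simp
  next
    case False
    then have pos: "0 < B v v"
      using semidefinite_form_nonneg[OF form v] by simp
    have "0 \<le> B v v * (B u u * B v v - (B u v)\<^sup>2)"
      using comb[of "B v v" "- B u v"] by (simp add: power2_eq_square algebra_simps)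
    then show ?thesis
      using pos by (simp add: zero_le_mult_iff)
  qed
  then have "sqrt ((B u v)\<^sup>2) \<le> sqrt (B u u * B v v)"
    by (rule real_sqrt_le_mono)
  then show ?thesis
    by (simp add: real_sqrt_mult)
qed

text \<open>
  Direct method: the quadratic functional \<open>J v = B v v - 2 * \<phi> v\<close> is bounded below because \<open>\<phi>\<close> is
  bounded, a minimising sequence is Cauchy by the parallelogram law, and at the limit of that
  sequence the first variation of \<open>J\<close> vanishes, which is the equation. The variation is taken
  along the sequence, before passing to the limit, where the Cauchy-Schwarz inequality gives the
  convergence of \<open>B (w k) z\<close>.
\<close>

theorem Riesz_representation:
  assumes form: "semidefinite_form V B"
    and complete: "\<And>w :: nat \<Rightarrow> 'a \<Rightarrow> real. (\<And>k. w k \<in> V) \<Longrightarrow>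
      (\<And>e. e > 0 \<Longrightarrow> \<exists>N. \<forall>k\<ge>N. \<forall>m\<ge>N.
         sqrt (B (\<lambda>x. w k x - w m x) (\<lambda>x. w k x - w m x)) < e) \<Longrightarrow>
      \<exists>v\<in>V. (\<lambda>k. sqrt (B (\<lambda>x. w k x - v x) (\<lambda>x. w k x - v x))) \<longlonglongrightarrow> 0"
    and linear: "\<And>u v a b. u \<in> V \<Longrightarrow> v \<in> V \<Longrightarrow>
      \<phi> (\<lambda>x. a * u x + b * v x) = a * \<phi> u + b * \<phi> v"
    and bounded: "\<And>v. v \<in> V \<Longrightarrow> \<bar>\<phi> v\<bar> \<le> C * sqrt (B v v)"
  shows "\<exists>u\<in>V. \<forall>v\<in>V. B u v = \<phi> v"
proof -
  note closed = semidefinite_form_closed[OF form] and form_nonneg = semidefinite_form_nonneg[OF form]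
  define J where "J v = B v v - 2 * \<phi> v" for v
  have J_combination: "J (\<lambda>x. a * u x + b * v x) =
      a\<^sup>2 * B u u + 2 * a * b * B u v + b\<^sup>2 * B v v - 2 * (a * \<phi> u + b * \<phi> v)"
    if "u \<in> V" "v \<in> V" for a b u v
    using that by (simp add: J_def form_square_combination[OF form] linear)
  \<comment> \<open>Completing the square in the seminorm of \<open>v\<close>.\<close>
  have "- C\<^sup>2 \<le> J v" if "v \<in> V" for v
  proof -
    have "0 \<le> (sqrt (B v v) - C)\<^sup>2"
      by simp
    then have "0 \<le> B v v - 2 * (C * sqrt (B v v)) + C\<^sup>2"
      using form_nonneg[OF that] by (simp add: power2_diff mult.commute)
    then show ?thesis
      using bounded[OF that] unfolding J_def by linarith
  qed
  then have bdd: "bdd_below (J ` V)"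
    by (auto simp: bdd_below_def)
  define d where "d = Inf (J ` V)"
  have d_le: "d \<le> J v" if "v \<in> V" for v
    using bdd that unfolding d_def by (simp add: cINF_lower)
  have "\<exists>v\<in>V. J v < d + inverse (real (Suc k))" for k
    using cInf_lessD[of "J ` V" "d + inverse (real (Suc k))"] semidefinite_form_nonempty[OF form]
    unfolding d_def by auto
  then obtain w where wV: "\<And>k. w k \<in> V" and w_min: "\<And>k. J (w k) < d + inverse (real (Suc k))"
    by metis
  have diff_le: "B (\<lambda>x. w k x - w m x) (\<lambda>x. w k x - w m x) \<le>
      2 * inverse (real (Suc k)) + 2 * inverse (real (Suc m))" for k m
  proof -
    \<comment> \<open>\<open>J\<close> is at least the infimum at the midpoint; the parallelogram law turns this into
      a bound on the distance of the two near-minimisers.\<close>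
    have "d \<le> J (\<lambda>x. 1/2 * w k x + 1/2 * w m x)"
      using d_le closed wV by blast
    then show ?thesis
      using w_min[of k] w_min[of m] J_combination[OF wV wV, of "1/2" k "1/2" m]
        form_square_diff[OF form wV wV, of k m]
      by (simp add: J_def power2_eq_square)
  qed
  have Cauchy: "\<exists>N. \<forall>k\<ge>N. \<forall>m\<ge>N. sqrt (B (\<lambda>x. w k x - w m x) (\<lambda>x. w k x - w m x)) < e"
    if "e > 0" for e
  proof -
    have "0 < e\<^sup>2 / 4"
      using that by simp
    then obtain N where N: "inverse (real (Suc N)) < e\<^sup>2 / 4"
      using reals_Archimedean by blast
    have "sqrt (B (\<lambda>x. w k x - w m x) (\<lambda>x. w k x - w m x)) < e" if "k \<ge> N" "m \<ge> N" for k m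
    proof -
      have "inverse (real (Suc k)) \<le> inverse (real (Suc N))"
        "inverse (real (Suc m)) \<le> inverse (real (Suc N))"
        using that by (auto intro!: le_imp_inverse_le)
      then have "B (\<lambda>x. w k x - w m x) (\<lambda>x. w k x - w m x) < e\<^sup>2"
        using diff_le[of k m] N by linarith
      then show ?thesis
        using \<open>e > 0\<close> real_sqrt_less_mono by fastforce
    qed
    then show ?thesis
      by blast
  qed
  obtain u where u: "u \<in> V"
    and lim: "(\<lambda>k. sqrt (B (\<lambda>x. w k x - u x) (\<lambda>x. w k x - u x))) \<longlonglongrightarrow> 0"
    using complete[of w, OF wV Cauchy] by blast
  have "B u z = \<phi> z" if z: "z \<in> V" for z
  proof -
    have "(\<lambda>k. B (\<lambda>x. w k x - u x) z) \<longlonglongrightarrow> 0"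
    proof (rule Lim_null_comparison)
      show "\<forall>\<^sub>F k in sequentially. norm (B (\<lambda>x. w k x - u x) z) \<le>
          sqrt (B (\<lambda>x. w k x - u x) (\<lambda>x. w k x - u x)) * sqrt (B z z)"
        using Cauchy_Schwarz_form[OF form semidefinite_form_diff_closed[OF form wV u] z] by simp
      show "(\<lambda>k. sqrt (B (\<lambda>x. w k x - u x) (\<lambda>x. w k x - u x)) * sqrt (B z z)) \<longlonglongrightarrow> 0"
        using tendsto_mult_left_zero[OF lim] .
    qed
    then have Bw: "(\<lambda>k. B (w k) z) \<longlonglongrightarrow> B u z"
      by (simp add: form_diff_left[OF form wV u z] LIM_zero_iff)
    have first_variation: "0 \<le> 2 * t * (B u z - \<phi> z) + t\<^sup>2 * B z z" for t
    proof (rule LIMSEQ_le_const)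
      have "(\<lambda>k. inverse (real (Suc k)) + 2 * t * (B (w k) z - \<phi> z) + t\<^sup>2 * B z z)
          \<longlonglongrightarrow> 0 + 2 * t * (B u z - \<phi> z) + t\<^sup>2 * B z z"
        by (intro tendsto_add tendsto_mult tendsto_diff tendsto_const LIMSEQ_inverse_real_of_nat Bw)
      then show "(\<lambda>k. inverse (real (Suc k)) + 2 * t * (B (w k) z - \<phi> z) + t\<^sup>2 * B z z)
          \<longlonglongrightarrow> 2 * t * (B u z - \<phi> z) + t\<^sup>2 * B z z"
        by simp
      have "0 \<le> inverse (real (Suc k)) + 2 * t * (B (w k) z - \<phi> z) + t\<^sup>2 * B z z" for k
        using d_le[OF closed[OF wV z, of 1 k t]] w_min[of k] J_combination[OF wV z, of 1 k t]
        by (simp add: J_def algebra_simps)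
      then show "\<exists>N. \<forall>k\<ge>N. 0 \<le>
          inverse (real (Suc k)) + 2 * t * (B (w k) z - \<phi> z) + t\<^sup>2 * B z z"
        by blast
    qed
    \<comment> \<open>The quadratic in \<open>t\<close> is evaluated at \<open>- y\<close>, close to its minimum; the \<open>+ 1\<close> avoids
      a division by zero when \<open>z\<close> has zero energy.\<close>
    define y where "y = (B u z - \<phi> z) / (B z z + 1)"
    have pos: "0 < B z z + 1"
      using form_nonneg[OF z] by simp
    then have y: "B u z - \<phi> z = y * (B z z + 1)"
      by (simp add: y_def)
    have "y\<^sup>2 * (B z z + 2) \<le> 0"
      using first_variation[of "- y"] unfolding y by (simp add: power2_eq_square algebra_simps)
    moreover have "0 < B z z + 2"
      using pos by simp
    ultimately have "y = 0"
      by (simp add: mult_le_0_iff)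
    then show ?thesis
      using y by simp
  qed
  with u show ?thesis
    by blast
qed


section \<open>Measurability on products\<close>

text \<open>
  A Lebesgue set is a Borel set up to a subset of a Borel null set, so a Borel function is
  Lebesgue-to-Lebesgue measurable as soon as preimages of null sets are null. For the projections
  such a preimage is a null set times the whole space.
\<close>

lemma measurable_lebesgueI:
  fixes f :: "'a::euclidean_space \<Rightarrow> 'b::euclidean_space"
  assumes borel: "f \<in> borel_measurable borel"
    and null: "\<And>N. N \<in> null_sets lborel \<Longrightarrow> emeasure lborel (f -` N) = 0"
  shows "f \<in> lebesgue \<rightarrow>\<^sub>M lebesgue"
proof (rule completion.measurable_completion2)
  have f_lborel: "f \<in> lborel \<rightarrow>\<^sub>M lborel"
    using borel by simp
  then show f_lebesgue: "f \<in> lebesgue \<rightarrow>\<^sub>M lborel"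
    by (rule measurable_completion)
  show "null_sets lborel \<subseteq> null_sets (distr lebesgue lborel f)"
  proof
    fix N :: "'b set"
    assume N: "N \<in> null_sets lborel"
    have "f -` N \<in> sets lborel"
      using measurable_sets[OF f_lborel, of N] N by (auto simp: null_sets_def)
    then show "N \<in> null_sets (distr lebesgue lborel f)"
      using N null[OF N] f_lebesgue by (simp add: null_sets_def emeasure_distr)
  qed
qed

lemma measurable_fst_lebesgue:
  "fst \<in> (lebesgue :: ('a::euclidean_space \<times> 'b::euclidean_space) measure) \<rightarrow>\<^sub>M lebesgue"
proof (rule measurable_lebesgueI)
  show "fst \<in> borel_measurable (borel :: ('a \<times> 'b) measure)"
    by (simp add: borel_prod[symmetric])
  fix N :: "'a set"
  have *: "fst -` N = N \<times> (UNIV :: 'b set)"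
    by auto
  show "N \<in> null_sets lborel \<Longrightarrow> emeasure (lborel :: ('a \<times> 'b) measure) (fst -` N) = 0"
    unfolding * by (simp add: lborel_prod[symmetric] lborel.emeasure_pair_measure_Times null_sets_def)
qed

lemma measurable_snd_lebesgue:
  "snd \<in> (lebesgue :: ('a::euclidean_space \<times> 'b::euclidean_space) measure) \<rightarrow>\<^sub>M lebesgue"
proof (rule measurable_lebesgueI)
  show "snd \<in> borel_measurable (borel :: ('a \<times> 'b) measure)"
    by (simp add: borel_prod[symmetric])
  fix N :: "'b set"
  have *: "snd -` N = (UNIV :: 'a set) \<times> N"
    by auto
  show "N \<in> null_sets lborel \<Longrightarrow> emeasure (lborel :: ('a \<times> 'b) measure) (snd -` N) = 0"
    unfolding * by (simp add: lborel_prod[symmetric] lborel.emeasure_pair_measure_Times null_sets_def)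
qed

lemma borel_measurable_lebesgue_on_product_fst:
  fixes f :: "'a::euclidean_space \<Rightarrow> real"
  assumes "f \<in> borel_measurable (lebesgue_on A)"
  shows "(\<lambda>p. f (fst p)) \<in> borel_measurable (lebesgue_on (A \<times> A))"
proof (rule measurable_compose[OF _ assms])
  show "fst \<in> lebesgue_on (A \<times> A) \<rightarrow>\<^sub>M lebesgue_on A"
    by (rule measurable_restrict_space3[OF measurable_fst_lebesgue]) auto
qed

lemma borel_measurable_lebesgue_on_product_snd:
  fixes f :: "'a::euclidean_space \<Rightarrow> real"
  assumes "f \<in> borel_measurable (lebesgue_on A)"
  shows "(\<lambda>p. f (snd p)) \<in> borel_measurable (lebesgue_on (A \<times> A))"
proof (rule measurable_compose[OF _ assms])
  show "snd \<in> lebesgue_on (A \<times> A) \<rightarrow>\<^sub>M lebesgue_on A"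
    by (rule measurable_restrict_space3[OF measurable_snd_lebesgue]) auto
qed


section \<open>Measurability of the global kernel\<close>

text \<open>
  The interaction domain is an open set, the neighbourhood of the subdomain of radius \<open>\<delta> i\<close>, with the
  subdomain removed.
\<close>

lemma borel_interaction_domain:
  assumes "open (Om i)"
  shows "interaction_domain Om \<delta> i \<in> sets borel"
proof -
  have "interaction_domain Om \<delta> i = (\<Union>x\<in>Om i. ball x (\<delta> i)) - Om i"
    by (auto simp: interaction_domain_def dist_norm)
  moreover have "open (\<Union>x\<in>Om i. ball x (\<delta> i))"
    by auto
  ultimately show ?thesis
    using assms by (simp add: sets.Diff borel_open)
qed

lemma open_subdomain: "interface_geometry Om \<delta> \<Longrightarrow> i \<in> {1, 2} \<Longrightarrow> open (Om i)"
  by (auto simp: interface_geometry_def)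

lemma borel_interaction_J:
  assumes "interface_geometry Om \<delta>" and "i \<in> {1, 2}"
  shows "interaction_J Om \<delta> i \<in> sets borel"
proof -
  have "open (Om (3 - i))"
    using open_subdomain[OF assms(1), of "3 - i"] assms(2) by auto
  then show ?thesis
    unfolding interaction_J_def
    by (intro sets.Int borel_interaction_domain open_subdomain[OF assms] borel_open)
qed

lemma borel_interaction_D:
  assumes "interface_geometry Om \<delta>" and "i \<in> {1, 2}"
  shows "interaction_D Om \<delta> i \<in> sets borel"
  unfolding interaction_D_def
  by (intro sets.Diff borel_interaction_domain open_subdomain[OF assms] borel_interaction_J[OF assms])

lemma borel_extended_subdomain:
  assumes "interface_geometry Om \<delta>" and "i \<in> {1, 2}"
  shows "extended_subdomain Om \<delta> i \<in> sets borel"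
  unfolding extended_subdomain_def
  by (intro sets.Un borel_interaction_domain open_subdomain[OF assms] borel_open)

text \<open>
  The given kernels are measurable only on the square of the extended subdomain; cutting them off
  outside that square makes them measurable on the whole space, and the kernel is then patched
  together from them along Borel sets.
\<close>

lemma borel_measurable_subdomain_kernel:
  assumes geometry: "interface_geometry Om \<delta>" and admissible: "admissible_kernels Om \<delta> g gJ"
    and i: "i \<in> {1, 2}"
  shows "(\<lambda>p. subdomain_kernel Om \<delta> g gJ i (fst p) (snd p) *
      indicator (extended_subdomain Om \<delta> i \<times> extended_subdomain Om \<delta> i) p)
    \<in> borel_measurable lebesgue"
proof -
  let ?E = "extended_subdomain Om \<delta> i"
  let ?J = "interaction_J Om \<delta> i"
  let ?D = "interaction_D Om \<delta> i"
  define N where "N = (?J \<union> ?D) \<times> (?J \<union> ?D)"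
  define A where "A = Om i \<times> ?J \<union> ?J \<times> Om i"
  define C where "C = (Om i \<union> ?D) \<times> (Om i \<union> ?D) - ?D \<times> ?D"
  note borel = borel_open[OF open_subdomain[OF geometry i]] borel_interaction_J[OF geometry i]
    borel_interaction_D[OF geometry i]
  have EE: "?E \<times> ?E \<in> sets lebesgue"
    by (intro sets_completionI_sets) (simp add: borel_Times borel_extended_subdomain[OF geometry i])
  have "N \<in> sets borel" "A \<in> sets borel" "C \<in> sets borel"
    unfolding N_def A_def C_def by (intro sets.Un sets.Diff borel_Times borel)+
  then have sets: "A - N \<in> sets lebesgue" "C - A - N \<in> sets lebesgue"
    by (simp_all add: sets.Diff)
  have "case_prod (g i) \<in> borel_measurable (lebesgue_on (?E \<times> ?E))"
    "case_prod (gJ i) \<in> borel_measurable (lebesgue_on (?E \<times> ?E))"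
    using bspec[OF admissible[unfolded admissible_kernels_def] i] by (simp_all add: Let_def)
  then have kernels:
    "(\<lambda>p. if p \<in> ?E \<times> ?E then case_prod (g i) p else 0) \<in> borel_measurable lebesgue"
    "(\<lambda>p. if p \<in> ?E \<times> ?E then case_prod (gJ i) p else 0) \<in> borel_measurable lebesgue"
    using borel_measurable_if_I EE by blast+
  have cases: "subdomain_kernel Om \<delta> g gJ i (fst p) (snd p) =
      (if p \<in> N then 0 else if p \<in> A then case_prod (gJ i) p else if p \<in> C then case_prod (g i) p else 0)"
    for p
    unfolding subdomain_kernel_def Let_def prod.collapse N_def A_def C_def case_prod_unfold ..
  have "(\<lambda>p. subdomain_kernel Om \<delta> g gJ i (fst p) (snd p) * indicator (?E \<times> ?E) p) =
      (\<lambda>p. indicator (A - N) p * (if p \<in> ?E \<times> ?E then case_prod (gJ i) p else 0)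
        + indicator (C - A - N) p * (if p \<in> ?E \<times> ?E then case_prod (g i) p else (0::real)))"
    unfolding cases by (rule ext) (simp add: indicator_def del: mem_Sigma_iff mem_Times_iff)
  then show ?thesis
    using kernels sets
    by (simp only: borel_measurable_add borel_measurable_times borel_measurable_indicator)
qed

lemma borel_measurable_global_kernel:
  assumes "interface_geometry Om \<delta>" and "admissible_kernels Om \<delta> g gJ"
  shows "(\<lambda>p. global_kernel Om \<delta> g gJ (fst p) (snd p)) \<in> borel_measurable (lebesgue_on S)"
proof -
  have "(\<lambda>p. global_kernel Om \<delta> g gJ (fst p) (snd p)) \<in> borel_measurable lebesgue"
    unfolding global_kernel_def prod.collapse
    by (rule borel_measurable_sum) (rule borel_measurable_subdomain_kernel[OF assms])
  then show ?thesis
    by (rule measurable_restrict_space1)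
qed


section \<open>The energy space as a space with a semidefinite form\<close>

lemma energy_space_L2: "v \<in> energy_space Om \<delta> g gJ \<Longrightarrow> v \<in> L2_space (total_domain Om \<delta>)"
  unfolding energy_space_def by blast

lemma energy_space_integrable:
  "v \<in> energy_space Om \<delta> g gJ \<Longrightarrow> integrable (lebesgue_on (total_domain Om \<delta> \<times> total_domain Om \<delta>))
    (\<lambda>p. (v (fst p) - v (snd p))\<^sup>2 * global_kernel Om \<delta> g gJ (fst p) (snd p))"
  unfolding energy_space_def case_prod_unfold by blast

lemma energy_space_Dirichlet:
  "v \<in> energy_space Om \<delta> g gJ \<Longrightarrow> i \<in> {1, 2} \<Longrightarrow>
    AE x in lebesgue_on (interaction_D Om \<delta> i). component Om \<delta> v i x = 0"
  unfolding energy_space_def by blast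

text \<open>
  The kernel may change sign, so the mixed integrand is compared with absolute values of the
  two energy densities.
\<close>

lemma integrable_energy_integrand:
  assumes geometry: "interface_geometry Om \<delta>" and admissible: "admissible_kernels Om \<delta> g gJ"
    and u: "u \<in> energy_space Om \<delta> g gJ" and v: "v \<in> energy_space Om \<delta> g gJ"
  shows "integrable (lebesgue_on (total_domain Om \<delta> \<times> total_domain Om \<delta>))
    (\<lambda>(x, y). (u x - u y) * (v x - v y) * global_kernel Om \<delta> g gJ x y)"
proof -
  let ?M = "lebesgue_on (total_domain Om \<delta> \<times> total_domain Om \<delta>)"
  let ?k = "\<lambda>p. global_kernel Om \<delta> g gJ (fst p) (snd p)"
  let ?u = "\<lambda>p. u (fst p) - u (snd p)"
  let ?v = "\<lambda>p. v (fst p) - v (snd p)"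
  have "u \<in> borel_measurable (lebesgue_on (total_domain Om \<delta>))"
    "v \<in> borel_measurable (lebesgue_on (total_domain Om \<delta>))"
    using energy_space_L2[OF u] energy_space_L2[OF v] by (simp_all add: L2_space_def)
  then have meas: "(\<lambda>p. ?u p * ?v p * ?k p) \<in> borel_measurable ?M"
    using borel_measurable_global_kernel[OF geometry admissible]
    by (intro borel_measurable_times borel_measurable_diff
        borel_measurable_lebesgue_on_product_fst borel_measurable_lebesgue_on_product_snd)
  have "integrable ?M (\<lambda>p. \<bar>(?u p)\<^sup>2 * ?k p\<bar> + \<bar>(?v p)\<^sup>2 * ?k p\<bar>)"
    by (intro Bochner_Integration.integrable_add integrable_abs energy_space_integrable u v)
  then have "integrable ?M (\<lambda>p. ?u p * ?v p * ?k p)"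
  proof (rule Bochner_Integration.integrable_bound[OF _ meas])
    have "\<bar>a * b * k\<bar> \<le> \<bar>a\<^sup>2 * k\<bar> + \<bar>b\<^sup>2 * k\<bar>" for a b k :: real
    proof -
      have "\<bar>a * b\<bar> \<le> a\<^sup>2 + b\<^sup>2"
        using sum_squares_bound[of "\<bar>a\<bar>" "\<bar>b\<bar>"] zero_le_power2[of a] zero_le_power2[of b]
          abs_ge_zero[of "a * b"]
        unfolding abs_mult power2_abs by linarith
      then have "\<bar>a * b\<bar> * \<bar>k\<bar> \<le> (a\<^sup>2 + b\<^sup>2) * \<bar>k\<bar>"
        by (rule mult_right_mono) simp
      then show ?thesis
        by (simp add: abs_mult distrib_right)
    qed
    then show "AE p in ?M. norm (?u p * ?v p * ?k p) \<le>
        norm (\<bar>(?u p)\<^sup>2 * ?k p\<bar> + \<bar>(?v p)\<^sup>2 * ?k p\<bar>)"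
      by simp
  qed
  then show ?thesis
    by (simp add: case_prod_unfold)
qed

lemma energy_form_commute: "energy_form Om \<delta> g gJ u v = energy_form Om \<delta> g gJ v u"
  by (simp add: energy_form_def mult.commute)

lemma energy_form_linear:
  assumes "interface_geometry Om \<delta>" and "admissible_kernels Om \<delta> g gJ"
    and "u \<in> energy_space Om \<delta> g gJ" "v \<in> energy_space Om \<delta> g gJ" "w \<in> energy_space Om \<delta> g gJ"
  shows "energy_form Om \<delta> g gJ (\<lambda>x. a * u x + b * v x) w =
    a * energy_form Om \<delta> g gJ u w + b * energy_form Om \<delta> g gJ v w"
proof -
  let ?M = "lebesgue_on (total_domain Om \<delta> \<times> total_domain Om \<delta>)"
  let ?I = "\<lambda>u p. (u (fst p) - u (snd p)) * (w (fst p) - w (snd p)) *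
    global_kernel Om \<delta> g gJ (fst p) (snd p)"
  have "integrable ?M (?I u)" "integrable ?M (?I v)"
    using integrable_energy_integrand[OF assms(1,2)] assms(3-) by (simp_all add: case_prod_unfold)
  then have "integral\<^sup>L ?M (\<lambda>p. a * ?I u p + b * ?I v p) =
      a * integral\<^sup>L ?M (?I u) + b * integral\<^sup>L ?M (?I v)"
    by simp
  moreover have "(\<lambda>p. a * ?I u p + b * ?I v p) = ?I (\<lambda>x. a * u x + b * v x)"
    by (auto simp: algebra_simps)
  ultimately show ?thesis
    by (simp add: energy_form_def case_prod_unfold)
qed

lemma L2_space_linear_combination:
  assumes "u \<in> L2_space A" "v \<in> L2_space A"
  shows "(\<lambda>x. a * u x + b * v x) \<in> L2_space A"
proof -
  have meas: "u \<in> borel_measurable (lebesgue_on A)" "v \<in> borel_measurable (lebesgue_on A)"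
    and sq: "integrable (lebesgue_on A) (\<lambda>x. 2 * a\<^sup>2 * (u x)\<^sup>2 + 2 * b\<^sup>2 * (v x)\<^sup>2)"
    using assms by (auto simp: L2_space_def)
  have "integrable (lebesgue_on A) (\<lambda>x. (a * u x + b * v x)\<^sup>2)"
  proof (rule Bochner_Integration.integrable_bound[OF sq])
    show "(\<lambda>x. (a * u x + b * v x)\<^sup>2) \<in> borel_measurable (lebesgue_on A)"
      using meas by measurable
    have "(a * s + b * t)\<^sup>2 \<le> 2 * a\<^sup>2 * s\<^sup>2 + 2 * b\<^sup>2 * t\<^sup>2" for s t
      using sum_squares_bound[of "a * s" "b * t"] by (simp add: power2_sum power_mult_distrib)
    then show "AE x in lebesgue_on A. norm ((a * u x + b * v x)\<^sup>2) \<le>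
        norm (2 * a\<^sup>2 * (u x)\<^sup>2 + 2 * b\<^sup>2 * (v x)\<^sup>2)"
      by simp
  qed
  then show ?thesis
    using meas by (simp add: L2_space_def)
qed

text \<open>
  Both components of a global function are therefore defined on the whole nonlocal interface, where
  they agree as restrictions of one function. For the local interface this uses that a boundary
  point of an open set lies outside the set but within any positive distance of it.
\<close>

lemma nonlocal_interface_subset:
  assumes "interface_geometry Om \<delta>" and "i \<in> {1, 2}"
  shows "nonlocal_interface Om \<delta> \<subseteq> extended_subdomain Om \<delta> i"
proof -
  have geometry: "open (Om 1)" "open (Om 2)" "0 < \<delta> 1" "0 < \<delta> 2"
    using assms(1) by (auto simp: interface_geometry_def)
  have "local_interface Om \<subseteq> interaction_domain Om \<delta> i"
  proof
    fix y
    assume "y \<in> local_interface Om"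
    then have "y \<in> frontier (Om i)" and "open (Om i)" and "0 < \<delta> i"
      using assms(2) geometry by (auto simp: local_interface_def)
    then have "y \<in> closure (Om i)" "y \<notin> Om i"
      by (auto simp: frontier_def interior_open)
    then show "y \<in> interaction_domain Om \<delta> i"
      using \<open>0 < \<delta> i\<close> by (auto simp: closure_approachable interaction_domain_def dist_norm)
  qed
  moreover have "interaction_J Om \<delta> 1 \<union> interaction_J Om \<delta> 2 \<subseteq> extended_subdomain Om \<delta> i"
    using assms(2) by (auto simp: interaction_J_def extended_subdomain_def)
  ultimately show ?thesis
    by (auto simp: nonlocal_interface_def extended_subdomain_def)
qed

lemma transmission_condition:
  assumes "interface_geometry Om \<delta>"
  shows "AE x in lebesgue_on (nonlocal_interface Om \<delta>). component Om \<delta> v 1 x = component Om \<delta> v 2 x"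
proof (rule AE_I2)
  fix x
  assume "x \<in> space (lebesgue_on (nonlocal_interface Om \<delta>))"
  then show "component Om \<delta> v 1 x = component Om \<delta> v 2 x"
    using nonlocal_interface_subset[OF assms, of 1] nonlocal_interface_subset[OF assms, of 2]
    by (auto simp: component_def)
qed

lemma zero_in_energy_space:
  assumes "interface_geometry Om \<delta>"
  shows "(\<lambda>x. 0) \<in> energy_space Om \<delta> g gJ"
proof -
  have "AE x in lebesgue_on (interaction_D Om \<delta> i). component Om \<delta> (\<lambda>x. 0) i x = 0" for i
    by (rule AE_I2) (auto simp: component_def interaction_D_def extended_subdomain_def)
  then show ?thesis
    using transmission_condition[OF assms]
    by (simp add: energy_space_def L2_space_def case_prod_unfold)
qed

lemma energy_space_linear_combination:
  assumes geometry: "interface_geometry Om \<delta>" and admissible: "admissible_kernels Om \<delta> g gJ"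
    and u: "u \<in> energy_space Om \<delta> g gJ" and v: "v \<in> energy_space Om \<delta> g gJ"
  shows "(\<lambda>x. a * u x + b * v x) \<in> energy_space Om \<delta> g gJ"
proof -
  let ?w = "\<lambda>x. a * u x + b * v x"
  let ?M = "lebesgue_on (total_domain Om \<delta> \<times> total_domain Om \<delta>)"
  let ?I = "\<lambda>u v p. (u (fst p) - u (snd p)) * (v (fst p) - v (snd p)) *
    global_kernel Om \<delta> g gJ (fst p) (snd p)"
  have "?w \<in> L2_space (total_domain Om \<delta>)"
    by (intro L2_space_linear_combination energy_space_L2[OF u] energy_space_L2[OF v])
  moreover have "integrable ?M (\<lambda>(x, y). (?w x - ?w y)\<^sup>2 * global_kernel Om \<delta> g gJ x y)"
  proof -
    have "integrable ?M (?I u u)" "integrable ?M (?I u v)" "integrable ?M (?I v v)"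
      using integrable_energy_integrand[OF geometry admissible] u v by (simp_all add: case_prod_unfold)
    then have "integrable ?M (\<lambda>p. a\<^sup>2 * ?I u u p + 2 * a * b * ?I u v p + b\<^sup>2 * ?I v v p)"
      by simp
    moreover have "(\<lambda>p. a\<^sup>2 * ?I u u p + 2 * a * b * ?I u v p + b\<^sup>2 * ?I v v p) =
        (\<lambda>(x, y). (?w x - ?w y)\<^sup>2 * global_kernel Om \<delta> g gJ x y)"
      by (auto simp: power2_eq_square algebra_simps)
    ultimately show ?thesis
      by simp
  qed
  moreover have "AE x in lebesgue_on (interaction_D Om \<delta> i). component Om \<delta> ?w i x = 0"
    if "i \<in> {1, 2}" for i
  proof -
    have "AE x in lebesgue_on (interaction_D Om \<delta> i). component Om \<delta> u i x = 0"
      "AE x in lebesgue_on (interaction_D Om \<delta> i). component Om \<delta> v i x = 0"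
      by (rule energy_space_Dirichlet[OF u that] energy_space_Dirichlet[OF v that])+
    with AE_space show ?thesis
      by eventually_elim (auto simp: component_def interaction_D_def extended_subdomain_def)
  qed
  ultimately show ?thesis
    using transmission_condition[OF geometry] by (simp add: energy_space_def)
qed


section \<open>Well-posedness\<close>

lemma L2_norm_nonneg: "0 \<le> L2_norm A v"
  by (simp add: L2_norm_def)

lemma L2_norm_le_Hs_norm: "L2_norm A v \<le> Hs_norm s A v"
proof -
  have "0 \<le> (LINT (x, y)|lebesgue_on (A \<times> A). gagliardo_quotient s v x y)"
    by (rule integral_nonneg_AE) (auto simp: gagliardo_quotient_def)
  then show ?thesis
    by (simp add: Hs_norm_def real_le_rsqrt)
qed

lemma L2_norm_le_zero_imp_AE:
  assumes "v \<in> L2_space A" and "L2_norm A v \<le> 0"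
  shows "AE x in lebesgue_on A. v x = 0"
proof -
  have int: "integrable (lebesgue_on A) (\<lambda>x. (v x)\<^sup>2)"
    using assms(1) by (simp add: L2_space_def)
  have "(LINT x|lebesgue_on A. (v x)\<^sup>2) = 0"
    using assms(2) by (simp add: L2_norm_def order_antisym)
  then show ?thesis
    using integral_nonneg_eq_0_iff_AE[OF int] by simp
qed

text \<open>
  What the two kernel classes have in common: a Sobolev norm dominates the \<open>L\<^sup>2\<close>-norm. This bound
  carries both the nonnegativity of the energy and its definiteness.
\<close>

lemma energy_norm_ge_L2_norm:
  assumes "(\<exists>s. fractional_kernel Om \<delta> g gJ s) \<or> square_integrable_kernel Om \<delta> g gJ"
    and "kernel_class_property Om \<delta> g gJ"
  shows "\<exists>c>0. \<forall>v\<in>energy_space Om \<delta> g gJ. c * L2_norm (total_domain Om \<delta>) v \<le> energy_norm Om \<delta> g gJ v"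
  using assms(1)
proof
  assume "\<exists>s. fractional_kernel Om \<delta> g gJ s"
  then obtain s c where "c > 0" and
    c: "\<forall>v\<in>energy_space Om \<delta> g gJ. c * Hs_norm s (total_domain Om \<delta>) v \<le> energy_norm Om \<delta> g gJ v"
    using assms(2) unfolding kernel_class_property_def equivalent_norms_on_def by metis
  have "c * L2_norm (total_domain Om \<delta>) v \<le> energy_norm Om \<delta> g gJ v"
    if "v \<in> energy_space Om \<delta> g gJ" for v
    using mult_left_mono[OF L2_norm_le_Hs_norm[of "total_domain Om \<delta>" v s] less_imp_le[OF \<open>c > 0\<close>]]
      bspec[OF c that] by linarith
  then show ?thesis
    using \<open>c > 0\<close> by blast
next
  assume "square_integrable_kernel Om \<delta> g gJ"
  then show ?thesis
    using assms(2) unfolding kernel_class_property_def equivalent_norms_on_def by metis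
qed

theorem theorem2p1:
  fixes Om :: "nat \<Rightarrow> (real ^ 'n) set"
    and \<delta> :: "nat \<Rightarrow> real"
    and g gJ :: "nat \<Rightarrow> real ^ 'n \<Rightarrow> real ^ 'n \<Rightarrow> real"
    and \<zeta> \<nu> :: "(real ^ 'n \<Rightarrow> real) \<Rightarrow> real"
  assumes "interface_geometry Om \<delta>"
    and "admissible_kernels Om \<delta> g gJ"
    and "(\<exists>s. fractional_kernel Om \<delta> g gJ s) \<or> square_integrable_kernel Om \<delta> g gJ"
    and "kernel_class_property Om \<delta> g gJ"
    and "\<zeta> \<in> dual_energy_space Om \<delta> g gJ"
    and "\<nu> \<in> dual_energy_space Om \<delta> g gJ"
  shows "\<exists>u\<in>energy_space Om \<delta> g gJ.
    (\<forall>v\<in>energy_space Om \<delta> g gJ. energy_form Om \<delta> g gJ u v = \<zeta> v + \<nu> v) \<and>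
    (\<forall>u'\<in>energy_space Om \<delta> g gJ.
       (\<forall>v\<in>energy_space Om \<delta> g gJ. energy_form Om \<delta> g gJ u' v = \<zeta> v + \<nu> v) \<longrightarrow>
       (AE x in lebesgue_on (total_domain Om \<delta>). u' x = u x))"
proof -
  let ?V = "energy_space Om \<delta> g gJ"
  let ?B = "energy_form Om \<delta> g gJ"
  let ?T = "total_domain Om \<delta>"
  obtain c where "c > 0" and c: "\<forall>v\<in>?V. c * L2_norm ?T v \<le> energy_norm Om \<delta> g gJ v"
    using energy_norm_ge_L2_norm[OF assms(3,4)] by blast
  have nonneg: "0 \<le> ?B v v" if "v \<in> ?V" for v
  proof -
    have "0 \<le> c * L2_norm ?T v"
      using \<open>c > 0\<close> L2_norm_nonneg[of ?T v] by simp
    \<comment> \<open>The root of a negative energy would be negative, so this bounds the energy itself.\<close>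
    then have "0 \<le> energy_norm Om \<delta> g gJ v"
      using bspec[OF c that] by linarith
    then show ?thesis
      by (simp add: energy_norm_def)
  qed
  have "?V \<noteq> {}"
    using zero_in_energy_space[OF assms(1)] by blast
  then have form: "semidefinite_form ?V ?B"
    using nonneg energy_space_linear_combination[OF assms(1,2)] energy_form_linear[OF assms(1,2)]
    unfolding semidefinite_form_def by (intro conjI ballI allI energy_form_commute) blast+
  have complete: "energy_complete Om \<delta> g gJ"
    using assms(3,4) by (auto simp: kernel_class_property_def)
  obtain C1 C2 where C: "\<forall>v\<in>?V. \<bar>\<zeta> v\<bar> \<le> C1 * energy_norm Om \<delta> g gJ v"
    "\<forall>v\<in>?V. \<bar>\<nu> v\<bar> \<le> C2 * energy_norm Om \<delta> g gJ v"
    using assms(5,6) by (auto simp: dual_energy_space_def)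
  have "\<exists>u\<in>?V. \<forall>v\<in>?V. ?B u v = \<zeta> v + \<nu> v"
  proof (rule Riesz_representation[OF form])
    show "\<zeta> (\<lambda>x. a * u x + b * v x) + \<nu> (\<lambda>x. a * u x + b * v x) =
        a * (\<zeta> u + \<nu> u) + b * (\<zeta> v + \<nu> v)" if "u \<in> ?V" "v \<in> ?V" for u v a b
      using assms(5,6) that by (simp add: dual_energy_space_def distrib_left)
    show "\<bar>\<zeta> v + \<nu> v\<bar> \<le> (C1 + C2) * sqrt (?B v v)" if "v \<in> ?V" for v
    proof -
      have "\<bar>\<zeta> v\<bar> \<le> C1 * sqrt (?B v v)" "\<bar>\<nu> v\<bar> \<le> C2 * sqrt (?B v v)"
        using C that by (auto simp: energy_norm_def)
      then show ?thesis
        by (simp add: distrib_right)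
    qed
    show "\<exists>v\<in>?V. (\<lambda>k. sqrt (?B (\<lambda>x. w k x - v x) (\<lambda>x. w k x - v x))) \<longlonglongrightarrow> 0"
      if "\<And>k. w k \<in> ?V"
        "\<And>e. e > 0 \<Longrightarrow> \<exists>N. \<forall>k\<ge>N. \<forall>m\<ge>N. sqrt (?B (\<lambda>x. w k x - w m x) (\<lambda>x. w k x - w m x)) < e"
      for w :: "nat \<Rightarrow> real ^ 'n \<Rightarrow> real"
      using complete[unfolded energy_complete_def energy_norm_def, rule_format, of w] that by simp
  qed
  then obtain u where u: "u \<in> ?V" and solves: "\<forall>v\<in>?V. ?B u v = \<zeta> v + \<nu> v"
    by blast
  have "AE x in lebesgue_on ?T. u' x = u x"
    if u': "u' \<in> ?V" and solves': "\<forall>v\<in>?V. ?B u' v = \<zeta> v + \<nu> v" for u'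
  proof -
    let ?d = "\<lambda>x. u' x - u x"
    have d: "?d \<in> ?V"
      using semidefinite_form_diff_closed[OF form u' u] .
    have "?B ?d ?d = 0"
      using form_diff_left[OF form u' u d] solves solves' d by simp
    then have "c * L2_norm ?T ?d \<le> 0"
      using c d by (auto simp: energy_norm_def)
    then have "L2_norm ?T ?d \<le> 0"
      using \<open>c > 0\<close> by (simp add: mult_le_0_iff)
    moreover have "?d \<in> L2_space ?T"
      using energy_space_L2[OF d] .
    ultimately have "AE x in lebesgue_on ?T. ?d x = 0"
      using L2_norm_le_zero_imp_AE by blast
    then show ?thesis
      by simp
  qed
  with u solves show ?thesis
    by blast
qed

end
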